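(* Let $G\ge2$, $\varepsilon_s\ge0$, fix real numbers $R_1,\dots,R_G$ and an index $j$, and put $\bar R=\frac1G\sum_iR_i$, $s_R^2=\frac1G\sum_i(R_i-\bar R)^2+\varepsilon_s$. For $\Delta\in\mathbb R$ replace $R_j$ by $R_j+\Delta$, i.e. let $R_i^{(\Delta)}=R_i+\Delta\mathbf 1\{i=j\}$, and let $\bar R_\Delta=\frac1G\sum_iR_i^{(\Delta)}$, $s_\Delta^2=\frac1G\sum_i(R_i^{(\Delta)}-\bar R_\Delta)^2+\varepsilon_s$, and $A_{i,\Delta}=(R_i^{(\Delta)}-\bar R_\Delta)/s_\Delta$, for values of $\Delta$ with $s_\Delta>0$ (in particular all $\Delta$ when $\varepsilon_s>0$). Then $$\bar R_\Delta=\bar R+\frac{\Delta}{G},\qquad s_\Delta^2=s_R^2+\frac{2\Delta(R_j-\bar R)}{G}+\frac{G-1}{G^2}\Delta^2 .$$ Moreover $\sum_iA_{i,\Delta}=0$, $\sum_iA_{i,\Delta}^2\le G$ and $\max_i|A_{i,\Delta}|\le\sqrt{G-1}$. As $|\Delta|\to\infty$, $$A_{j,\Delta}-\operatorname{sign}(\Delta)\sqrt{G-1}\to0,\qquad A_{i,\Delta}+\frac{\operatorname{sign}(\Delta)}{\sqrt{G-1}}\to0\quad(i\ne j).$$ Consequently, when $G\ge3$, any two indices $i,k\ne j$ satisfy $A_{i,\Delta}-A_{k,\Delta}=(R_i-R_k)/s_\Delta\to0$ as $|\Delta|\to\infty$.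
   Context: The $R_i$ are rewards of a group of $G$ responses and $A_{i,\Delta}$ are the mean–RMS normalized (GRPO) advantages after one reward is perturbed. *)

theory Defs
  imports Complex_Main
begin

text \<open>
  A group of \<open>G\<close> rewards is a function \<open>R :: nat \<Rightarrow> real\<close>, of which only the values at the
  indices \<open>1, \<dots>, G\<close> are used.
\<close>

definition group_mean :: "nat \<Rightarrow> (nat \<Rightarrow> real) \<Rightarrow> real" where
  "group_mean G R = (1 / real G) * (\<Sum>i=1..G. R i)"

text \<open>
  The scale \<open>s\<close> is given through its square, so it is taken to be the nonnegative root.
\<close>

definition group_scale :: "real \<Rightarrow> nat \<Rightarrow> (nat \<Rightarrow> real) \<Rightarrow> real" where
  "group_scale \<epsilon> G R =
     sqrt ((1 / real G) * (\<Sum>i=1..G. (R i - group_mean G R)\<^sup>2) + \<epsilon>)"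

text \<open>
  Where the scale is zero the advantage is undefined on paper; here it is \<open>0\<close> by the convention
  \<open>x / 0 = 0\<close>, so statements about it should assume a positive scale.
\<close>

definition group_advantage :: "real \<Rightarrow> nat \<Rightarrow> (nat \<Rightarrow> real) \<Rightarrow> nat \<Rightarrow> real" where
  "group_advantage \<epsilon> G R i = (R i - group_mean G R) / group_scale \<epsilon> G R"

definition perturb_reward :: "(nat \<Rightarrow> real) \<Rightarrow> nat \<Rightarrow> real \<Rightarrow> nat \<Rightarrow> real" where
  "perturb_reward R j \<Delta> i = R i + \<Delta> * (if i = j then 1 else 0)"

end

theory Submission
  imports "HOL-Analysis.Analysis" Defs
begin

text \<open>
  Perturbing one reward shifts the deviations \<open>R\<^sub>i - m\<close> by \<open>\<Delta> (\<delta>\<^sub>i\<^sub>j - 1/G)\<close>, and the unperturbed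
  deviations sum to \<open>0\<close>; expanding the square gives the formula for the squared scale.  Cauchy-Schwarz
  over the indices other than \<open>i\<close> bounds \<open>A\<^sub>i\<^sup>2\<close> by \<open>G - 1\<close>.  The squared scale is a quadratic with
  leading coefficient \<open>c = (G - 1)/G\<^sup>2\<close>, so the scale grows like \<open>sqrt c * \<bar>\<Delta>\<bar>\<close>, and the limits follow
  on dividing numerator and denominator by \<open>\<bar>\<Delta>\<bar>\<close>.
\<close>

lemma sum_deviation_eq_0:
  assumes "G > 0"
  shows "(\<Sum>i=1..G. R i - group_mean G R) = 0"
  using assms by (simp add: group_mean_def sum_subtractf)

lemma group_scale_power2:
  assumes "\<epsilon> \<ge> 0"
  shows "(group_scale \<epsilon> G R)\<^sup>2 = (1 / real G) * (\<Sum>i=1..G. (R i - group_mean G R)\<^sup>2) + \<epsilon>"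
  using assms by (simp add: group_scale_def sum_nonneg)

lemma group_scale_nonneg: "\<epsilon> \<ge> 0 \<Longrightarrow> group_scale \<epsilon> G R \<ge> 0"
  by (simp add: group_scale_def sum_nonneg)

lemma group_scale_pos: "\<epsilon> > 0 \<Longrightarrow> group_scale \<epsilon> G R > 0"
  by (simp add: group_scale_def sum_nonneg add_nonneg_pos)

lemma group_mean_perturb:
  assumes "j \<in> {1..G}"
  shows "group_mean G (perturb_reward R j \<Delta>) = group_mean G R + \<Delta> / real G"
proof -
  have "(\<Sum>i=1..G. perturb_reward R j \<Delta> i) = (\<Sum>i=1..G. R i) + \<Delta>"
    using assms by (simp add: perturb_reward_def sum.distrib flip: sum_distrib_left)
  then show ?thesis
    by (simp add: group_mean_def add_divide_distrib)
qed

lemma group_scale_perturb_power2: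
  assumes "j \<in> {1..G}" "\<epsilon> \<ge> 0"
  shows "(group_scale \<epsilon> G (perturb_reward R j \<Delta>))\<^sup>2 = (group_scale \<epsilon> G R)\<^sup>2
           + 2 * \<Delta> * (R j - group_mean G R) / real G + (real G - 1) / (real G)\<^sup>2 * \<Delta>\<^sup>2"
proof -
  have G: "G > 0" using assms by simp
  define d where "d i = R i - group_mean G R" for i
  define e where "e i = (if i = j then 1 else 0 :: real)" for i
  have sum_d: "(\<Sum>i=1..G. d i) = 0"
    using sum_deviation_eq_0[OF G, of R] by (simp add: d_def)
  have sum_e: "(\<Sum>i=1..G. e i) = 1" and sum_de: "(\<Sum>i=1..G. d i * e i) = d j"
    using assms(1) by (simp_all add: e_def if_distrib cong: if_cong)
  \<comment> \<open>The deviation after the perturbation is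
    \<open>d i + \<Delta> * (e i - 1/G)\<close>. Since \<open>e i\<close> is 0 or 1, its square is
    \<open>e i\<close> itself, which leaves every summand linear in \<open>e i\<close>.\<close>
  have "(\<Sum>i=1..G. (perturb_reward R j \<Delta> i - group_mean G (perturb_reward R j \<Delta>))\<^sup>2)
      = (\<Sum>i=1..G. (d i)\<^sup>2 + 2 * \<Delta> * (d i * e i) - 2 * \<Delta> / G * d i
          + \<Delta>\<^sup>2 * (1 - 2 / G) * e i + \<Delta>\<^sup>2 / G\<^sup>2)"
    using G by (intro sum.cong refl)
      (simp add: group_mean_perturb[OF assms(1)] d_def perturb_reward_def e_def field_simps power2_eq_square)
  also have "\<dots> = (\<Sum>i=1..G. (d i)\<^sup>2) + 2 * \<Delta> * d j + \<Delta>\<^sup>2 * (1 - 2 / G) + \<Delta>\<^sup>2 / G"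
    unfolding sum.distrib sum_subtractf sum_distrib_left[symmetric] sum_d sum_e sum_de
    using G by (simp add: power2_eq_square)
  \<comment> \<open>The two pure \<open>\<Delta>\<^sup>2\<close> terms combine to
    \<open>\<Delta>\<^sup>2 * (1 - 1/G)\<close>; the averaging factor \<open>1/G\<close> turns this
    into the coefficient \<open>(G - 1)/G\<^sup>2\<close>.\<close>
  finally show ?thesis
    unfolding group_scale_power2[OF assms(2)] d_def[symmetric] using G
    by (simp only:) (simp add: field_simps power2_eq_square flip: sum_distrib_left)
qed

lemma sum_advantage_eq_0:
  assumes "G > 0"
  shows "(\<Sum>i=1..G. group_advantage \<epsilon> G R i) = 0"
  using sum_deviation_eq_0[OF assms, of R]
  by (simp add: group_advantage_def flip: sum_divide_distrib)

text \<open>The squared deviations sum to \<open>G * (s\<^sup>2 - \<epsilon>)\<close> with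
  \<open>s\<close> the scale, and dividing by \<open>s\<^sup>2\<close> leaves at most
  \<open>G\<close>. At \<open>s = 0\<close> all advantages are 0 by the division convention, so the
  bound persists.\<close>

lemma sum_advantage_power2_le:
  assumes "\<epsilon> \<ge> 0"
  shows "(\<Sum>i=1..G. (group_advantage \<epsilon> G R i)\<^sup>2) \<le> real G"
proof (cases "G = 0 \<or> group_scale \<epsilon> G R = 0")
  case True
  then show ?thesis by (auto simp: group_advantage_def)
next
  case False
  then have G: "real G > 0" and s: "(group_scale \<epsilon> G R)\<^sup>2 > 0" by auto
  have "(\<Sum>i=1..G. (R i - group_mean G R)\<^sup>2) = real G * ((group_scale \<epsilon> G R)\<^sup>2 - \<epsilon>)"
    using G by (simp add: group_scale_power2[OF assms])
  also have "\<dots> \<le> real G * (group_scale \<epsilon> G R)\<^sup>2"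
    using assms by (intro mult_left_mono) auto
  finally show ?thesis
    using s by (simp add: group_advantage_def power_divide divide_le_eq flip: sum_divide_distrib)
qed

lemma power2_le_of_sum_eq_0:
  fixes x :: "'a \<Rightarrow> real"
  assumes "finite I" "k \<in> I" "(\<Sum>i\<in>I. x i) = 0" "(\<Sum>i\<in>I. (x i)\<^sup>2) \<le> real (card I)"
  shows "(x k)\<^sup>2 \<le> real (card I) - 1"
proof -
  let ?J = "I - {k}" and ?n = "real (card I)"
  have n: "?n > 0" using assms by (auto simp: card_gt_0_iff)
  have cJ: "real (card ?J) = ?n - 1"
    using assms n by (simp add: card_Diff_singleton of_nat_diff)
  have "x k = - (\<Sum>i\<in>?J. x i)"
    using assms by (simp add: sum_diff1)
  then have "(x k)\<^sup>2 = (\<Sum>i\<in>?J. x i)\<^sup>2" by simp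
  also have "\<dots> \<le> (?n - 1) * (\<Sum>i\<in>?J. (x i)\<^sup>2)"
    using sum_squared_le_sum_of_squares[of x ?J] assms(1) cJ by (simp add: mult.commute)
  also have "\<dots> \<le> (?n - 1) * (?n - (x k)\<^sup>2)"
    using assms cJ by (intro mult_left_mono) (auto simp: sum_diff1 simp flip: cJ)
  \<comment> \<open>The unknown \<open>(x k)\<^sup>2\<close> stands on both sides of the chain;
    moving it to the left gives it the factor \<open>?n\<close>, which then cancels.\<close>
  finally have "?n * (x k)\<^sup>2 \<le> ?n * (?n - 1)" by (simp add: algebra_simps)
  then show ?thesis using n by simp
qed

lemma abs_advantage_le:
  assumes "\<epsilon> \<ge> 0" "i \<in> {1..G}"
  shows "\<bar>group_advantage \<epsilon> G R i\<bar> \<le> sqrt (real G - 1)"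
proof (rule real_le_rsqrt)
  show "\<bar>group_advantage \<epsilon> G R i\<bar>\<^sup>2 \<le> real G - 1"
    using power2_le_of_sum_eq_0[of "{1..G}" i "group_advantage \<epsilon> G R"] assms
      sum_advantage_power2_le[of \<epsilon> G R] sum_advantage_eq_0[of G \<epsilon> R]
    by simp
qed

lemma tendsto_const_over_at_infinity: "((\<lambda>x::real. p / x) \<longlongrightarrow> 0) at_infinity"
  using tendsto_mult[OF tendsto_const tendsto_inverse_0, of p] by (simp add: divide_inverse)

text \<open>Dividing by \<open>\<bar>x\<bar>\<close> rather than \<open>x\<close> keeps the quotient
  nonnegative, so it is the root of its square \<open>a/x\<^sup>2 + b/x + c\<close>, with one limit
  at both ends of the line.\<close>

lemma sqrt_quadratic_over_abs_tendsto:
  fixes s :: "real \<Rightarrow> real"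
  assumes "\<And>x. s x \<ge> 0" "\<And>x. (s x)\<^sup>2 = a + b * x + c * x\<^sup>2"
  shows "((\<lambda>x. s x / \<bar>x\<bar>) \<longlongrightarrow> sqrt c) at_infinity"
proof -
  have lim: "((\<lambda>x::real. sqrt (a / x / x + b / x + c)) \<longlongrightarrow> sqrt (0 + 0 + c)) at_infinity"
    using tendsto_mult[OF tendsto_const_over_at_infinity[of a] tendsto_const_over_at_infinity[of 1]]
    by (intro tendsto_intros tendsto_const_over_at_infinity) simp_all
  have "s x / \<bar>x\<bar> = sqrt (a / x / x + b / x + c)" if "x \<noteq> 0" for x
  proof -
    have "(s x / \<bar>x\<bar>)\<^sup>2 = (a + b * x + c * x\<^sup>2) / x\<^sup>2"
      by (simp add: power_divide assms(2))
    also have "\<dots> = a / x / x + b / x + c"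
      using that by (simp add: add_divide_distrib power2_eq_square)
    finally have "a / x / x + b / x + c = (s x / \<bar>x\<bar>)\<^sup>2" ..
    then show ?thesis using assms(1)[of x] by simp
  qed
  then show ?thesis
    using lim eventually_not_equal_at_infinity[of "0::real"]
    by (auto elim!: Lim_transform_eventually eventually_mono)
qed

text \<open>The filter \<open>at_infinity\<close> covers both ends of the real line, where the
  quotient has opposite limits if \<open>q\<close> is nonzero. The term with \<open>sgn x\<close> is
  therefore subtracted inside the limit; it arises from
  \<open>x / \<bar>x\<bar> = sgn x\<close>.\<close>

lemma affine_over_sqrt_quadratic_tendsto:
  fixes s :: "real \<Rightarrow> real"
  assumes "c > 0" "\<And>x. s x \<ge> 0" "\<And>x. (s x)\<^sup>2 = a + b * x + c * x\<^sup>2"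
  shows "((\<lambda>x. (p + q * x) / s x - sgn x * (q / sqrt c)) \<longlongrightarrow> 0) at_infinity"
proof -
  define u where "u x = s x / \<bar>x\<bar>" for x
  have u: "((\<lambda>x. inverse (u x)) \<longlongrightarrow> inverse (sqrt c)) at_infinity"
    unfolding u_def using sqrt_quadratic_over_abs_tendsto[OF assms(2,3)] assms(1)
    by (intro tendsto_inverse) auto
  have "((\<lambda>x. p / \<bar>x\<bar>) \<longlongrightarrow> 0) at_infinity"
    using tendsto_rabs_zero[OF tendsto_const_over_at_infinity[of p]]
    by (subst tendsto_rabs_zero_iff[symmetric]) simp
  then have 1: "((\<lambda>x. p / \<bar>x\<bar> * inverse (u x)) \<longlongrightarrow> 0) at_infinity"
    using tendsto_mult[OF _ u] by fastforce
  have diff: "((\<lambda>x. q * (inverse (u x) - inverse (sqrt c))) \<longlongrightarrow> 0) at_infinity"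
    using tendsto_mult[OF tendsto_const tendsto_diff[OF u tendsto_const[of "inverse (sqrt c)"]], of q]
    by simp
  \<comment> \<open>The factor \<open>sgn x\<close> has no limit at infinity, but it is bounded by
    1, so comparison with \<open>diff\<close> suffices.\<close>
  have 2: "((\<lambda>x. sgn x * (q * (inverse (u x) - inverse (sqrt c)))) \<longlongrightarrow> 0) at_infinity"
    by (rule Lim_null_comparison[OF _ tendsto_rabs_zero[OF diff]])
      (auto simp: abs_mult abs_sgn_eq)
  have eq: "(p + q * x) / s x - sgn x * (q / sqrt c)
      = p / \<bar>x\<bar> * inverse (u x) + sgn x * (q * (inverse (u x) - inverse (sqrt c)))"
    if "x \<noteq> 0" for x
    \<comment> \<open>If \<open>s x = 0\<close>, then \<open>u x = 0\<close> as well, and both sides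
      reduce to \<open>- sgn x * q / sqrt c\<close> because division by zero yields 0.\<close>
    using that by (cases "s x = 0") (simp_all add: u_def field_simps sgn_if)
  show ?thesis
    using tendsto_add[OF 1 2] eq eventually_not_equal_at_infinity[of "0::real"]
    by (auto elim!: Lim_transform_eventually eventually_mono)
qed

theorem proposition2p1:
  fixes G j :: nat and \<epsilon> :: real and R :: "nat \<Rightarrow> real"
    and m s :: "real \<Rightarrow> real" and A :: "nat \<Rightarrow> real \<Rightarrow> real"
  defines "m \<equiv> \<lambda>\<Delta>. group_mean G (perturb_reward R j \<Delta>)"
    and "s \<equiv> \<lambda>\<Delta>. group_scale \<epsilon> G (perturb_reward R j \<Delta>)"
    and "A \<equiv> \<lambda>i \<Delta>. group_advantage \<epsilon> G (perturb_reward R j \<Delta>) i"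
  assumes "G \<ge> 2" and "\<epsilon> \<ge> 0" and "j \<in> {1..G}"
  shows "(\<forall>\<Delta>. m \<Delta> = group_mean G R + \<Delta> / real G)
    \<and> (\<forall>\<Delta>. (s \<Delta>)\<^sup>2 = (group_scale \<epsilon> G R)\<^sup>2 + 2 * \<Delta> * (R j - group_mean G R) / real G
                         + (real G - 1) / (real G)\<^sup>2 * \<Delta>\<^sup>2)
    \<and> (\<epsilon> > 0 \<longrightarrow> (\<forall>\<Delta>. s \<Delta> > 0))
    \<and> (\<forall>\<Delta>. s \<Delta> > 0 \<longrightarrow>
          (\<Sum>i=1..G. A i \<Delta>) = 0
        \<and> (\<Sum>i=1..G. (A i \<Delta>)\<^sup>2) \<le> real G
        \<and> (MAX i\<in>{1..G}. \<bar>A i \<Delta>\<bar>) \<le> sqrt (real G - 1))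
    \<and> (\<forall>\<^sub>F \<Delta> in at_infinity. s \<Delta> > 0)
    \<and> ((\<lambda>\<Delta>. A j \<Delta> - sgn \<Delta> * sqrt (real G - 1)) \<longlongrightarrow> 0) at_infinity
    \<and> (\<forall>i\<in>{1..G}. i \<noteq> j \<longrightarrow>
          ((\<lambda>\<Delta>. A i \<Delta> + sgn \<Delta> / sqrt (real G - 1)) \<longlongrightarrow> 0) at_infinity)
    \<and> (G \<ge> 3 \<longrightarrow> (\<forall>i\<in>{1..G}. \<forall>k\<in>{1..G}. i \<noteq> j \<longrightarrow> k \<noteq> j \<longrightarrow>
          (\<forall>\<Delta>. s \<Delta> > 0 \<longrightarrow> A i \<Delta> - A k \<Delta> = (R i - R k) / s \<Delta>)
        \<and> ((\<lambda>\<Delta>. A i \<Delta> - A k \<Delta>) \<longlongrightarrow> 0) at_infinity))"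
proof -
  have G: "real G > 1" "G > 0" using assms(4) by auto
  define a where "a = (group_scale \<epsilon> G R)\<^sup>2"
  define b where "b = 2 * (R j - group_mean G R) / real G"
  define c where "c = (real G - 1) / (real G)\<^sup>2"
  \<comment> \<open>This is the slope in \<open>\<Delta>\<close> of the \<open>i\<close>-th
    deviation: \<open>(G - 1)/G\<close> for \<open>i = j\<close> and \<open>-1/G\<close> otherwise.
    Division by \<open>sqrt c = sqrt (G - 1)/G\<close> produces the two limit values.\<close>
  define q where "q i = (if i = j then 1 else 0) - 1 / real G" for i
  have c: "c > 0" using G by (simp add: c_def)
  have sqrt_c: "sqrt c = sqrt (real G - 1) / real G"
    using G by (simp add: c_def real_sqrt_divide)
  have mean: "m \<Delta> = group_mean G R + \<Delta> / real G" for \<Delta>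
    unfolding m_def by (rule group_mean_perturb[OF assms(6)])
  have scale: "(s \<Delta>)\<^sup>2 = (group_scale \<epsilon> G R)\<^sup>2 + 2 * \<Delta> * (R j - group_mean G R) / real G
      + (real G - 1) / (real G)\<^sup>2 * \<Delta>\<^sup>2" for \<Delta>
    unfolding s_def by (rule group_scale_perturb_power2[OF assms(6,5)])
  have s_nonneg: "s \<Delta> \<ge> 0" for \<Delta>
    unfolding s_def by (rule group_scale_nonneg[OF assms(5)])
  have s_quad: "(s \<Delta>)\<^sup>2 = a + b * \<Delta> + c * \<Delta>\<^sup>2" for \<Delta>
    unfolding scale by (simp add: a_def b_def c_def)
  have A_eq: "A i \<Delta> = ((R i - group_mean G R) + q i * \<Delta>) / s \<Delta>" for i \<Delta>
    unfolding A_def group_advantage_def using mean[of \<Delta>]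
    by (simp add: m_def s_def q_def perturb_reward_def algebra_simps)
  have lim: "((\<lambda>\<Delta>. A i \<Delta> - sgn \<Delta> * (q i / sqrt c)) \<longlongrightarrow> 0) at_infinity" for i
    unfolding A_eq by (rule affine_over_sqrt_quadratic_tendsto[OF c s_nonneg s_quad])
  have "sqrt (real G - 1) > 0" "sqrt (real G - 1) * sqrt (real G - 1) = real G - 1"
    using G by simp_all
  then have q_j: "q j / sqrt c = sqrt (real G - 1)"
    using G by (simp add: sqrt_c q_def field_simps)
  have q_i: "q i / sqrt c = - (1 / sqrt (real G - 1))" if "i \<noteq> j" for i
    using G that by (simp add: sqrt_c q_def field_simps)
  have max_A: "(MAX i\<in>{1..G}. \<bar>A i \<Delta>\<bar>) \<le> sqrt (real G - 1)" for \<Delta>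
    using G abs_advantage_le[OF assms(5)] unfolding A_def by (subst Max_le_iff) auto
  \<comment> \<open>This makes the limits meaningful when \<open>\<epsilon> = 0\<close>: far out,
    the advantages are genuine quotients and not default values.\<close>
  have s_pos: "\<forall>\<^sub>F \<Delta> in at_infinity. s \<Delta> > 0"
  proof -
    have "\<forall>\<^sub>F \<Delta> in at_infinity. s \<Delta> / \<bar>\<Delta>\<bar> > 0"
      using order_tendstoD(1)[OF sqrt_quadratic_over_abs_tendsto[OF s_nonneg s_quad], of 0] c
      by simp
    then show ?thesis by eventually_elim (auto simp: zero_less_divide_iff)
  qed
  \<comment> \<open>Away from \<open>j\<close> both advantages have the same sign term, which
    cancels in the difference.\<close>
  have lim_diff: "((\<lambda>\<Delta>. A i \<Delta> - A k \<Delta>) \<longlongrightarrow> 0) at_infinity" if "i \<noteq> j" "k \<noteq> j" for i k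
    using tendsto_diff[OF lim[of i] lim[of k]] by (simp add: q_i[OF that(1)] q_i[OF that(2)])
  have diff_eq: "A i \<Delta> - A k \<Delta> = (R i - R k) / s \<Delta>" if "i \<noteq> j" "k \<noteq> j" for i k \<Delta>
    using that by (simp add: A_eq q_def flip: diff_divide_distrib)
  show ?thesis
  proof (intro conjI allI impI ballI)
    show "s \<Delta> > 0" if "\<epsilon> > 0" for \<Delta>
      unfolding s_def using that by (rule group_scale_pos)
    show "(\<Sum>i=1..G. A i \<Delta>) = 0" for \<Delta>
      unfolding A_def by (rule sum_advantage_eq_0[OF G(2)])
    show "(\<Sum>i=1..G. (A i \<Delta>)\<^sup>2) \<le> real G" for \<Delta>
      unfolding A_def by (rule sum_advantage_power2_le[OF assms(5)])
    show "((\<lambda>\<Delta>. A j \<Delta> - sgn \<Delta> * sqrt (real G - 1)) \<longlongrightarrow> 0) at_infinity"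
      using lim[of j] by (simp add: q_j)
    show "((\<lambda>\<Delta>. A i \<Delta> + sgn \<Delta> / sqrt (real G - 1)) \<longlongrightarrow> 0) at_infinity" if "i \<noteq> j" for i
      using lim[of i] by (simp add: q_i[OF that])
  qed (use mean scale max_A s_pos diff_eq lim_diff in blast)+
qed

end
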